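(* For every instance of the repair scheduling problem described in the context with $m$ identical repair crews, the LP-midpoint list scheduling algorithm described in the context is a $2$-approximation. That is, if $H$ is the cost of any schedule produced by the algorithm and $H^{m,\ast}$ is the minimum cost over all feasible $m$-crew schedules, then $H \le 2\,H^{m,\ast}$.
   Context: Problem instance. A finite nonempty set $L$ of jobs (damaged edges of a radial, i.e. tree-shaped, distribution network with one source at the root) is given, with repair times $p_j \ge 0$ and positive weights $w_j$ for $j\in L$. The set $L$ is partitioned into nonempty groups called islands; $\mathcal{J}$ denotes the set of islands. A rooted tree $P$ on $\mathcal{J}$ is given, with edges directed away from the root (the group soft precedence graph). Write $J' \preceq_S J$ if $J'=J$ or $J'$ is an ancestor of $J$ in $P$, and $(J'\to J)\in P$ if $J'$ is the parent of $J$. The weight of an island is $\omega_J := \sum_{j\in J} w_j$. Schedules. There are $m\ge 1$ identical crews. A feasible $m$-crew schedule assigns each job to exactly one crew and gives it a start time $S_j\ge 0$, without preemption, each crew working on at most one job at a time. The completion time is $C_j=S_j+p_j$. Jobs may be started in any order: the tree $P$ does not restrict the order of repairs and enters only through energization times. The energization time of island $J$ is $E_J := \max_{J'\preceq_S J}\max_{j\in J'} C_j$. The cost of a schedule is $\sum_{J\in\mathcal{J}}\omega_J E_J$, to be minimized. LP relaxation. With real variables $C_j$ ($j\in L$) and $E_J$ ($J\in\mathcal{J}$), minimize $\sum_{J\in\mathcal{J}} \omega_J E_J$ subject to: $C_j\ge p_j$ for all $j\in L$; $E_J\ge C_j$ for all $J\in\mathcal{J}$ and $j\in J$; $E_J\ge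 E_{J'}$ for all $(J'\to J)\in P$; and, for every $A\subseteq L$, $$\sum_{j\in A}p_jC_j\ \ge\ \frac{1}{2m}\Big(\sum_{j\in A}p_j\Big)^2+\frac12\sum_{j\in A}p_j^2 .$$ Algorithm. Let $C^{LP}$ be the completion time vector of an optimal LP solution, and let $M_j^{LP}:=C_j^{LP}-p_j/2$. Form a priority list of all jobs by sorting the $M_j^{LP}$ in ascending order, breaking ties according to the group soft precedence constraints (jobs of ancestor islands first), or arbitrarily if there is none. Starting at time $0$, whenever a crew is free, assign to it the next job from the priority list. *)

theory Defs
  imports Complex_Main "HOL-Library.Disjoint_Sets"
begin

text \<open>
  Jobs are the elements of a set \<open>L\<close>, and an island is literally a set of jobs, so that the
  set \<open>\<J>\<close> of islands is a partition of \<open>L\<close>. The soft precedence graph is a relation \<open>P\<close> on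
  islands whose pairs \<open>(J', J)\<close> point from parent to child; hence \<open>P\<^sup>*\<close> is the order
  ``equal or ancestor'', and \<open>P\<^sup>+\<close> is the strict ancestor relation.
\<close>

definition rooted_tree :: "'v set \<Rightarrow> ('v \<times> 'v) set \<Rightarrow> bool" where
  "rooted_tree V P \<longleftrightarrow>
     P \<subseteq> V \<times> V \<and>
     (\<exists>r\<in>V. (\<forall>u. (u, r) \<notin> P) \<and>
            (\<forall>v\<in>V - {r}. \<exists>!u. (u, v) \<in> P) \<and>
            (\<forall>v\<in>V. (r, v) \<in> P\<^sup>*))"

definition island_weight :: "('j \<Rightarrow> real) \<Rightarrow> 'j set \<Rightarrow> real" where
  "island_weight w J = (\<Sum>j\<in>J. w j)"

text \<open>The \<open>m\<close> crews are the numbers below \<open>m\<close>.\<close>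

record 'j schedule =
  crew :: "'j \<Rightarrow> nat"
  start :: "'j \<Rightarrow> real"

definition completion :: "('j \<Rightarrow> real) \<Rightarrow> 'j schedule \<Rightarrow> 'j \<Rightarrow> real" where
  "completion p \<sigma> j = start \<sigma> j + p j"

definition feasible_schedule ::
    "'j set \<Rightarrow> ('j \<Rightarrow> real) \<Rightarrow> nat \<Rightarrow> 'j schedule \<Rightarrow> bool" where
  "feasible_schedule L p m \<sigma> \<longleftrightarrow>
     (\<forall>j\<in>L. crew \<sigma> j < m \<and> start \<sigma> j \<ge> 0) \<and>
     (\<forall>i\<in>L. \<forall>j\<in>L. i \<noteq> j \<longrightarrow> crew \<sigma> i = crew \<sigma> j \<longrightarrow>
        completion p \<sigma> i \<le> start \<sigma> j \<or> completion p \<sigma> j \<le> start \<sigma> i)"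

definition energization ::
    "'j set set \<Rightarrow> ('j set \<times> 'j set) set \<Rightarrow> ('j \<Rightarrow> real) \<Rightarrow> 'j set \<Rightarrow> real" where
  "energization \<J> P C J = Max ((\<lambda>J'. Max (C ` J')) ` {J' \<in> \<J>. (J', J) \<in> P\<^sup>*})"

definition schedule_cost ::
    "('j \<Rightarrow> real) \<Rightarrow> ('j \<Rightarrow> real) \<Rightarrow> 'j set set \<Rightarrow> ('j set \<times> 'j set) set \<Rightarrow> 'j schedule \<Rightarrow> real" where
  "schedule_cost p w \<J> P \<sigma> =
     (\<Sum>J\<in>\<J>. island_weight w J * energization \<J> P (completion p \<sigma>) J)"

text \<open>
  An LP solution is a pair \<open>(C, E)\<close>; its values outside \<open>L\<close> and \<open>\<J>\<close> are irrelevant.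
\<close>

definition lp_feasible ::
    "'j set \<Rightarrow> ('j \<Rightarrow> real) \<Rightarrow> 'j set set \<Rightarrow> ('j set \<times> 'j set) set \<Rightarrow> nat \<Rightarrow>
     ('j \<Rightarrow> real) \<times> ('j set \<Rightarrow> real) \<Rightarrow> bool" where
  "lp_feasible L p \<J> P m = (\<lambda>(C, E).
     (\<forall>j\<in>L. C j \<ge> p j) \<and>
     (\<forall>J\<in>\<J>. \<forall>j\<in>J. E J \<ge> C j) \<and>
     (\<forall>(J', J)\<in>P. E J \<ge> E J') \<and>
     (\<forall>A\<subseteq>L. (\<Sum>j\<in>A. p j * C j) \<ge>
        1 / (2 * real m) * (\<Sum>j\<in>A. p j)\<^sup>2 + 1 / 2 * (\<Sum>j\<in>A. (p j)\<^sup>2)))"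

definition lp_objective ::
    "('j \<Rightarrow> real) \<Rightarrow> 'j set set \<Rightarrow> ('j \<Rightarrow> real) \<times> ('j set \<Rightarrow> real) \<Rightarrow> real" where
  "lp_objective w \<J> = (\<lambda>(C, E). \<Sum>J\<in>\<J>. island_weight w J * E J)"

definition midpoint :: "('j \<Rightarrow> real) \<Rightarrow> ('j \<Rightarrow> real) \<Rightarrow> 'j \<Rightarrow> real" where
  "midpoint p C j = C j - p j / 2"

text \<open>
  In a priority list, if \<open>i\<close> occurs before \<open>j\<close> then the key of \<open>i\<close> is at most that of \<open>j\<close>,
  and if the keys are equal then the island of \<open>j\<close> is not a strict ancestor of that of \<open>i\<close>.
\<close>

definition priority_list ::
    "'j set \<Rightarrow> 'j set set \<Rightarrow> ('j set \<times> 'j set) set \<Rightarrow> ('j \<Rightarrow> real) \<Rightarrow> 'j list \<Rightarrow> bool" where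
  "priority_list L \<J> P M xs \<longleftrightarrow>
     distinct xs \<and> set xs = L \<and>
     sorted_wrt (\<lambda>i j. M i \<le> M j \<and>
       (M i = M j \<longrightarrow> (\<forall>I\<in>\<J>. \<forall>J\<in>\<J>. i \<in> I \<longrightarrow> j \<in> J \<longrightarrow> (J, I) \<notin> P\<^sup>+))) xs"

text \<open>
  \<open>list_schedule p m f xs \<sigma>\<close>: \<open>\<sigma>\<close> is a possible outcome on \<open>xs\<close> of list scheduling
  when crew \<open>c\<close> becomes free at time \<open>f c\<close>. The next job goes to a crew that is free first,
  at the time it becomes free; a tie between crews may be resolved either way.
\<close>

primrec list_schedule ::
    "('j \<Rightarrow> real) \<Rightarrow> nat \<Rightarrow> (nat \<Rightarrow> real) \<Rightarrow> 'j list \<Rightarrow> 'j schedule \<Rightarrow> bool" where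
  "list_schedule p m f [] \<sigma> \<longleftrightarrow> True"
| "list_schedule p m f (j # xs) \<sigma> \<longleftrightarrow>
     is_arg_min f (\<lambda>c. c < m) (crew \<sigma> j) \<and>
     start \<sigma> j = f (crew \<sigma> j) \<and>
     list_schedule p m (f(crew \<sigma> j := completion p \<sigma> j)) xs \<sigma>"

definition lp_midpoint_schedule ::
    "'j set \<Rightarrow> ('j \<Rightarrow> real) \<Rightarrow> ('j \<Rightarrow> real) \<Rightarrow> 'j set set \<Rightarrow> ('j set \<times> 'j set) set \<Rightarrow> nat \<Rightarrow>
     'j schedule \<Rightarrow> bool" where
  "lp_midpoint_schedule L p w \<J> P m \<sigma> \<longleftrightarrow>
     (\<exists>C E xs. is_arg_min (lp_objective w \<J>) (lp_feasible L p \<J> P m) (C, E) \<and>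
               priority_list L \<J> P (midpoint p C) xs \<and>
               list_schedule p m (\<lambda>c. 0) xs \<sigma>)"

end

theory Submission
  imports Defs "HOL-Analysis.Convex"
begin

text \<open>
  If \<open>A\<close> consists of the jobs up to and including \<open>j\<close> in the priority list, then all midpoints in
  \<open>A\<close> are at most that of \<open>j\<close>, so the LP inequality for \<open>A\<close> gives \<open>M j \<ge> p(A) / (2 m)\<close>. List
  scheduling starts \<open>j\<close> no later than the average load \<open>(p(A) - p j) / m\<close> of the preceding jobs,
  hence completes it by \<open>2 M j + p j = 2 C j\<close>. Energization times are maxima of completion times
  and inherit the factor 2. The LP optimum is a lower bound on the optimal cost, because the
  completion times of any feasible schedule satisfy the LP inequalities: on one crew this is
  induction removing the last job, and Cauchy--Schwarz combines the \<open>m\<close> crews.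
\<close>

text \<open>Induction removes a job \<open>k\<close> of latest start: the other jobs fit before
  \<open>S k\<close>, and \<open>k\<close> itself fits between \<open>S k\<close> and
  \<open>T\<close>.\<close>

lemma sequential_load_le:
  fixes S p :: "'a \<Rightarrow> real" and T :: real
  assumes "finite A"
    and "\<And>i. i \<in> A \<Longrightarrow> p i \<ge> 0" and "\<And>i. i \<in> A \<Longrightarrow> S i \<ge> 0"
    and "\<And>i j. i \<in> A \<Longrightarrow> j \<in> A \<Longrightarrow> i \<noteq> j \<Longrightarrow> S i + p i \<le> S j \<or> S j + p j \<le> S i"
    and "\<And>i. i \<in> A \<Longrightarrow> S i + p i \<le> T" and "T \<ge> 0"
  shows "sum p A \<le> T"
  using assms
proof (induction "card A" arbitrary: A T)
  case 0
  then show ?case by simp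
next
  case (Suc n)
  have "S ` A \<noteq> {}" "finite (S ` A)" using Suc.hyps Suc.prems(1) by auto
  then obtain k where k: "k \<in> A" "S k = Max (S ` A)"
    by (metis (no_types, lifting) Max_in imageE)
  have last: "S i \<le> S k" if "i \<in> A" for i
    using that k(2) \<open>finite (S ` A)\<close> by simp
  have card: "n = card (A - {k})" using Suc.hyps k(1) Suc.prems(1) by simp
  have split: "sum p A = p k + sum p (A - {k})"
    using Suc.prems(1) k(1) by (simp add: sum.remove)
  show ?case
  \<comment> \<open>A job of length 0 may share its start with a longer job, which then need not end
    by \<open>S k\<close>. Dropping the empty job keeps the horizon \<open>T\<close>
    instead.\<close>
  proof (cases "p k = 0")
    case True
    have "sum p (A - {k}) \<le> T"
      by (rule Suc.hyps(1)[OF card]) (use Suc.prems in auto)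
    with split True show ?thesis by simp
  next
    case False
    then have "p k > 0" using Suc.prems(2)[OF k(1)] by simp
    then have before: "S i + p i \<le> S k" if "i \<in> A - {k}" for i
      using that Suc.prems(4)[of i k] last[of i] k(1) by force
    have "sum p (A - {k}) \<le> S k"
      by (rule Suc.hyps(1)[OF card]) (use Suc.prems k(1) before in auto)
    with split Suc.prems(5)[OF k(1)] show ?thesis by simp
  qed
qed

text \<open>Removing a job \<open>k\<close> that completes last lowers the left side by exactly
  \<open>p k * sum p A\<close> and the right side by \<open>p k * (S k + p k)\<close>. The load
  bound compares the two.\<close>

lemma single_crew_inequality:
  fixes S p :: "'a \<Rightarrow> real"
  assumes "finite A"
    and "\<And>i. i \<in> A \<Longrightarrow> p i \<ge> 0" and "\<And>i. i \<in> A \<Longrightarrow> S i \<ge> 0"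
    and "\<And>i j. i \<in> A \<Longrightarrow> j \<in> A \<Longrightarrow> i \<noteq> j \<Longrightarrow> S i + p i \<le> S j \<or> S j + p j \<le> S i"
  shows "1 / 2 * (sum p A)\<^sup>2 + 1 / 2 * (\<Sum>i\<in>A. (p i)\<^sup>2) \<le> (\<Sum>i\<in>A. p i * (S i + p i))"
  using assms
proof (induction "card A" arbitrary: A)
  case 0
  then show ?case by simp
next
  case (Suc n)
  let ?C = "\<lambda>i. S i + p i"
  have "?C ` A \<noteq> {}" and fin: "finite (?C ` A)" using Suc.hyps Suc.prems(1) by auto
  then obtain k where k: "k \<in> A" "?C k = Max (?C ` A)"
    by (metis (no_types, lifting) Max_in imageE)
  have "?C i \<le> ?C k" if "i \<in> A" for i
    using that k(2) fin by simp
  moreover have "?C k \<ge> 0" using Suc.prems(2,3) k(1) by simp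
  ultimately have "sum p A \<le> ?C k"
    using Suc.prems by (intro sequential_load_le[where S = S]) auto
  then have last: "p k * sum p A \<le> p k * ?C k"
    using Suc.prems(2)[OF k(1)] by (rule mult_left_mono)
  have IH: "1 / 2 * (sum p (A - {k}))\<^sup>2 + 1 / 2 * (\<Sum>i\<in>A - {k}. (p i)\<^sup>2)
      \<le> (\<Sum>i\<in>A - {k}. p i * ?C i)"
    by (rule Suc.hyps(1)) (use Suc.hyps Suc.prems k in auto)
  have split: "sum g A = g k + sum g (A - {k})" for g :: "'a \<Rightarrow> real"
    using Suc.prems(1) k(1) by (simp add: sum.remove)
  show ?case
    using IH last unfolding split by (simp add: power2_eq_square algebra_simps)
qed

lemma parallel_inequality:
  assumes "finite A" and p: "\<And>j. j \<in> A \<Longrightarrow> p j \<ge> 0" and "m \<ge> 1"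
    and feas: "feasible_schedule A p m \<sigma>"
  shows "1 / (2 * real m) * (sum p A)\<^sup>2 + 1 / 2 * (\<Sum>j\<in>A. (p j)\<^sup>2)
    \<le> (\<Sum>j\<in>A. p j * completion p \<sigma> j)"
proof -
  define B where "B c = {j \<in> A. crew \<sigma> j = c}" for c
  have fin: "finite (B c)" for c using assms(1) by (simp add: B_def)
  have group: "sum g A = (\<Sum>c<m. sum g (B c))" for g :: "'a \<Rightarrow> real"
    unfolding B_def using assms(1) feas
    by (intro sum.group[symmetric]) (auto simp: feasible_schedule_def)
  have one: "1 / 2 * (sum p (B c))\<^sup>2 + 1 / 2 * (\<Sum>j\<in>B c. (p j)\<^sup>2)
      \<le> (\<Sum>j\<in>B c. p j * completion p \<sigma> j)" for c
    unfolding completion_def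
    using fin p feas
    by (intro single_crew_inequality) (auto simp: B_def feasible_schedule_def completion_def)
  \<comment> \<open>Cauchy-Schwarz over the \<open>m\<close> crew loads is the source of the factor
    \<open>1 / m\<close>; the other terms simply add up over crews.\<close>
  have "(sum p A)\<^sup>2 \<le> real m * (\<Sum>c<m. (sum p (B c))\<^sup>2)"
    using sum_squared_le_sum_of_squares[of "\<lambda>c. sum p (B c)" "{..<m}"]
    by (simp add: group mult.commute)
  then have "1 / (2 * real m) * (sum p A)\<^sup>2 \<le> 1 / 2 * (\<Sum>c<m. (sum p (B c))\<^sup>2)"
    using \<open>m \<ge> 1\<close> by (simp add: field_simps)
  moreover have "1 / 2 * (\<Sum>c<m. (sum p (B c))\<^sup>2) + 1 / 2 * (\<Sum>j\<in>A. (p j)\<^sup>2)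
      \<le> (\<Sum>j\<in>A. p j * completion p \<sigma> j)"
    unfolding group[of "\<lambda>j. (p j)\<^sup>2"] group[of "\<lambda>j. p j * _ j"] sum_distrib_left
      sum.distrib[symmetric]
    using one by (intro sum_mono) (simp add: sum_distrib_left)
  ultimately show ?thesis by linarith
qed

text \<open>The total of the free times grows by exactly \<open>p y\<close> with each assigned job
  \<open>y\<close>, since no crew idles. The next job starts at the least free time, which is at
  most the average. The free times \<open>f\<close> are arbitrary because the recursion updates
  them.\<close>

lemma list_schedule_start_le:
  assumes "list_schedule p m f (ys @ j # zs) \<sigma>"
  shows "real m * start \<sigma> j \<le> (\<Sum>c<m. f c) + sum_list (map p ys)"
  using assms
proof (induction ys arbitrary: f)
  case Nil
  then have "start \<sigma> j \<le> f c" if "c < m" for c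
    using that by (auto simp: is_arg_min_linorder)
  then show ?case
    using sum_bounded_below[of "{..<m}" "start \<sigma> j" f] by simp
next
  case (Cons y ys)
  define c where "c = crew \<sigma> y"
  have c: "c < m" "start \<sigma> y = f c"
    using Cons.prems by (auto simp: c_def is_arg_min_def)
  have "(\<Sum>d<m. (f(c := completion p \<sigma> y)) d) = (\<Sum>d<m. f d) + p y"
    using c by (simp add: sum.remove[of "{..<m}" c] completion_def del: fun_upd_apply)
       (simp add: completion_def)
  then show ?case
    using Cons.IH[of "f(c := completion p \<sigma> y)"] Cons.prems
    by (simp add: c_def del: fun_upd_apply)
qed

text \<open>Passing from \<open>C\<close> to midpoints absorbs the sum of squares in the LP
  inequality. What remains is at most \<open>M * sum p A\<close>, and one factor
  \<open>sum p A\<close> cancels.\<close>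

lemma midpoint_ge_load:
  fixes C p :: "'a \<Rightarrow> real"
  assumes p: "\<And>i. i \<in> A \<Longrightarrow> p i \<ge> 0" and "m \<ge> 1"
    and lp: "1 / (2 * real m) * (sum p A)\<^sup>2 + 1 / 2 * (\<Sum>i\<in>A. (p i)\<^sup>2) \<le> (\<Sum>i\<in>A. p i * C i)"
    and le: "\<And>i. i \<in> A \<Longrightarrow> midpoint p C i \<le> M" and "M \<ge> 0"
  shows "sum p A \<le> 2 * real m * M"
\<comment> \<open>With zero load nothing can be cancelled; the bound then rests on
  \<open>M \<ge> 0\<close>.\<close>
proof (cases "sum p A = 0")
  case True
  then show ?thesis using \<open>M \<ge> 0\<close> by simp
next
  case False
  then have pos: "sum p A > 0" using sum_nonneg[of A p] p by simp
  have "1 / (2 * real m) * (sum p A)\<^sup>2 \<le> (\<Sum>i\<in>A. p i * midpoint p C i)"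
    using lp by (simp add: midpoint_def right_diff_distrib sum_subtractf sum_divide_distrib
        power2_eq_square)
  also have "\<dots> \<le> M * sum p A"
    using p le unfolding sum_distrib_left
    by (intro sum_mono) (simp add: mult.commute[of M] mult_left_mono)
  finally have "sum p A * sum p A \<le> (2 * real m * M) * sum p A"
    using \<open>m \<ge> 1\<close> by (simp add: field_simps power2_eq_square)
  then show ?thesis using pos by simp
qed

lemma list_schedule_completion_le:
  assumes p: "\<And>j. j \<in> L \<Longrightarrow> p j \<ge> 0" and "m \<ge> 1"
    and lp: "lp_feasible L p \<J> P m (C, E)"
    and prio: "priority_list L \<J> P (midpoint p C) xs"
    and ls: "list_schedule p m (\<lambda>c. 0) xs \<sigma>"
    and j: "j \<in> L"
  shows "completion p \<sigma> j \<le> 2 * C j"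
proof -
  have "j \<in> set xs" using prio j by (simp add: priority_list_def)
  then obtain ys zs where xs: "xs = ys @ j # zs" by (meson split_list)
  let ?A = "insert j (set ys)"
  have sub: "?A \<subseteq> L" and dist: "distinct ys" "j \<notin> set ys"
    and le: "\<And>i. i \<in> ?A \<Longrightarrow> midpoint p C i \<le> midpoint p C j"
    using prio by (auto simp: priority_list_def xs sorted_wrt_append)
  have "C j \<ge> p j" using lp j by (simp add: lp_feasible_def)
  then have M: "midpoint p C j \<ge> 0" using p[OF j] by (simp add: midpoint_def)
  have "1 / (2 * real m) * (sum p ?A)\<^sup>2 + 1 / 2 * (\<Sum>i\<in>?A. (p i)\<^sup>2) \<le> (\<Sum>i\<in>?A. p i * C i)"
    using lp sub unfolding lp_feasible_def by blast
  then have "sum p ?A \<le> 2 * real m * midpoint p C j"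
    using sub p \<open>m \<ge> 1\<close> le M by (intro midpoint_ge_load) auto
  moreover have "real m * start \<sigma> j \<le> sum p (set ys)"
    using list_schedule_start_le[of p m "\<lambda>c. 0" ys j zs \<sigma>] ls dist
    by (simp add: xs sum_list_distinct_conv_sum_set)
  ultimately have "real m * start \<sigma> j \<le> real m * (2 * midpoint p C j)"
    using dist p[OF j] by simp
  \<comment> \<open>Twice the midpoint is \<open>2 * C j - p j\<close>, which leaves exactly the
    room to process \<open>j\<close>.\<close>
  then have "start \<sigma> j \<le> 2 * midpoint p C j" using \<open>m \<ge> 1\<close> by simp
  then show ?thesis by (simp add: completion_def midpoint_def)
qed

text \<open>Describing the nested maximum by its upper bounds lets later arguments avoid
  \<open>Max\<close>. The outer maximum ranges over a nonempty set because \<open>J\<close> precedes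
  itself.\<close>

lemma energization_le_iff:
  assumes "finite \<J>" and "\<And>J. J \<in> \<J> \<Longrightarrow> finite J \<and> J \<noteq> {}" and "J \<in> \<J>"
  shows "energization \<J> P C J \<le> T \<longleftrightarrow> (\<forall>J'\<in>\<J>. (J', J) \<in> P\<^sup>* \<longrightarrow> (\<forall>j\<in>J'. C j \<le> T))"
proof -
  have "{J' \<in> \<J>. (J', J) \<in> P\<^sup>*} \<noteq> {}" using assms(3) by blast
  then show ?thesis
    using assms(1,2) by (auto simp: energization_def)
qed

text \<open>This makes the LP a relaxation: the actual energization times serve as the values of
  \<open>E\<close>.\<close>

lemma schedule_lp_feasible:
  assumes "finite L" and p: "\<And>j. j \<in> L \<Longrightarrow> p j \<ge> 0" and "m \<ge> 1"
    and part: "partition_on L \<J>" and P: "P \<subseteq> \<J> \<times> \<J>"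
    and feas: "feasible_schedule L p m \<sigma>"
  shows "lp_feasible L p \<J> P m (completion p \<sigma>, energization \<J> P (completion p \<sigma>))"
proof -
  have fin: "finite \<J>" using finite_elements[OF assms(1) part] .
  have isl: "finite J \<and> J \<noteq> {}" if "J \<in> \<J>" for J
    using that part assms(1) by (metis finite_subset partition_onD1 partition_onD3 Union_upper)
  note en = energization_le_iff[OF fin isl]
  \<comment> \<open>Feasibility is inherited by subsets, so the parallel inequality is available for
    every \<open>A\<close>.\<close>
  have "feasible_schedule A p m \<sigma>" if "A \<subseteq> L" for A
    using feas that unfolding feasible_schedule_def by blast
  then have "1 / (2 * real m) * (sum p A)\<^sup>2 + 1 / 2 * (\<Sum>j\<in>A. (p j)\<^sup>2)
      \<le> (\<Sum>j\<in>A. p j * completion p \<sigma> j)" if "A \<subseteq> L" for A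
    using that assms(1) p \<open>m \<ge> 1\<close>
    by (intro parallel_inequality) (auto intro: finite_subset)
  moreover have "completion p \<sigma> j \<ge> p j" if "j \<in> L" for j
    using feas that by (simp add: feasible_schedule_def completion_def)
  moreover have "completion p \<sigma> j \<le> energization \<J> P (completion p \<sigma>) J"
    if "J \<in> \<J>" "j \<in> J" for J j
    \<comment> \<open>Taking the energization time itself as the bound \<open>T\<close> makes the
      left side of the equivalence trivial.\<close>
    using en[OF _ that(1), of P "completion p \<sigma>" "energization \<J> P (completion p \<sigma>) J"] that
    by blast
  moreover have "energization \<J> P (completion p \<sigma>) J' \<le> energization \<J> P (completion p \<sigma>) J"
    if "(J', J) \<in> P" for J' J
  proof -
    have J: "J' \<in> \<J>" "J \<in> \<J>" using that P by auto
    have "(I, J) \<in> P\<^sup>*" if "(I, J') \<in> P\<^sup>*" for I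
      using that \<open>(J', J) \<in> P\<close> by (rule rtrancl_into_rtrancl)
    then show ?thesis
      using en[OF _ J(2), of P "completion p \<sigma>" "energization \<J> P (completion p \<sigma>) J"]
      by (simp add: en[OF _ J(1)])
  qed
  ultimately show ?thesis unfolding lp_feasible_def by auto
qed

text \<open>The LP constraints make \<open>E\<close> monotone along \<open>P\<close>, so
  \<open>E J\<close> dominates \<open>C\<close> on all ancestors of \<open>J\<close> as
  well.\<close>

lemma lp_energization_le:
  assumes "finite L" and part: "partition_on L \<J>"
    and lp: "lp_feasible L p \<J> P m (C, E)"
    and D: "\<And>j. j \<in> L \<Longrightarrow> D j \<le> 2 * C j" and J: "J \<in> \<J>"
  shows "energization \<J> P D J \<le> 2 * E J"
proof -
  have fin: "finite \<J>" using finite_elements[OF assms(1) part] .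
  have isl: "finite J \<and> J \<noteq> {}" if "J \<in> \<J>" for J
    using that part assms(1) by (metis finite_subset partition_onD1 partition_onD3 Union_upper)
  have mono: "E J' \<le> E J" if "(J', J) \<in> P\<^sup>*" for J'
    using that by induction (use lp in \<open>auto simp: lp_feasible_def intro: order_trans\<close>)
  have "D j \<le> 2 * E J" if "J' \<in> \<J>" "(J', J) \<in> P\<^sup>*" "j \<in> J'" for J' j
  proof -
    have "j \<in> L" using that part by (auto simp: partition_on_def)
    moreover have "C j \<le> E J'" using lp that by (simp add: lp_feasible_def)
    ultimately show ?thesis using D[of j] mono[OF that(2)] by linarith
  qed
  then show ?thesis using energization_le_iff[OF fin isl J] by simp
qed

theorem theorem2:
  fixes L :: "'j set" and p w :: "'j \<Rightarrow> real"
    and \<J> :: "'j set set" and P :: "('j set \<times> 'j set) set"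
    and m :: nat and \<sigma> \<tau> :: "'j schedule" and H Hopt :: real
  assumes "finite L" and "L \<noteq> {}"
    and "\<And>j. j \<in> L \<Longrightarrow> p j \<ge> 0"
    and "\<And>j. j \<in> L \<Longrightarrow> w j > 0"
    and "partition_on L \<J>"
    and "rooted_tree \<J> P"
    and "m \<ge> 1"
    and "lp_midpoint_schedule L p w \<J> P m \<sigma>"
    and "H = schedule_cost p w \<J> P \<sigma>"
    and "is_arg_min (schedule_cost p w \<J> P) (feasible_schedule L p m) \<tau>"
    and "Hopt = schedule_cost p w \<J> P \<tau>"
  shows "H \<le> 2 * Hopt"
proof -
  obtain C E xs where opt: "is_arg_min (lp_objective w \<J>) (lp_feasible L p \<J> P m) (C, E)"
    and prio: "priority_list L \<J> P (midpoint p C) xs"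
    and ls: "list_schedule p m (\<lambda>c. 0) xs \<sigma>"
    using assms(8) by (auto simp: lp_midpoint_schedule_def)
  have lp: "lp_feasible L p \<J> P m (C, E)" using opt by (simp add: is_arg_min_def)
  have weight: "island_weight w J \<ge> 0" if "J \<in> \<J>" for J
    unfolding island_weight_def using that assms(4,5)
    by (intro sum_nonneg) (auto simp: partition_on_def intro: less_imp_le)
  have "energization \<J> P (completion p \<sigma>) J \<le> 2 * E J" if "J \<in> \<J>" for J
    using list_schedule_completion_le[OF assms(3,7) lp prio ls] that
    by (rule lp_energization_le[OF assms(1,5) lp])
  then have "H \<le> (\<Sum>J\<in>\<J>. island_weight w J * (2 * E J))"
    unfolding assms(9) schedule_cost_def using weight
    by (intro sum_mono mult_left_mono)
  also have "\<dots> = 2 * lp_objective w \<J> (C, E)"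
    by (simp add: lp_objective_def sum_distrib_left mult.left_commute)
  finally have "H \<le> 2 * lp_objective w \<J> (C, E)" .
  \<comment> \<open>The LP point induced by \<open>\<tau>\<close> is feasible and its objective is
    the cost of \<open>\<tau>\<close>, so it bounds the LP optimum from above.\<close>
  moreover have "lp_objective w \<J> (C, E)
      \<le> lp_objective w \<J> (completion p \<tau>, energization \<J> P (completion p \<tau>))"
  proof -
    have "P \<subseteq> \<J> \<times> \<J>" using assms(6) by (simp add: rooted_tree_def)
    moreover have "feasible_schedule L p m \<tau>" using assms(10) by (simp add: is_arg_min_def)
    ultimately show ?thesis
      using opt schedule_lp_feasible[OF assms(1,3,7,5)] by (simp add: is_arg_min_linorder)
  qed
  moreover have "\<dots> = Hopt"
    by (simp add: assms(11) schedule_cost_def lp_objective_def)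
  ultimately show ?thesis by linarith
qed

end
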